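(* Let $n,k,p,N\in\mathbb{N}$ with $k<n$. Consider the full-order port-Hamiltonian system $$\dot x(t)=(J_{2n}-R)\mathcal{H}x(t)+Bu(t),\qquad y(t)=B^{*}\mathcal{H}x(t),$$ where $J_{2n}\in\mathbb{C}^{2n\times 2n}$ is invertible with $J_{2n}^{*}=-J_{2n}$, $R=R^{*}\ge 0$ and $\mathcal{H}=\mathcal{H}^{*}>0$ are in $\mathbb{C}^{2n\times 2n}$, and $B\in\mathbb{C}^{2n\times p}$; let $G$ be its transfer function. Let $J_{2k}\in\mathbb{C}^{2k\times 2k}$ be invertible with $J_{2k}^{*}=-J_{2k}$. Take $$Q_{\mathsf{E}}=\begin{bmatrix}Q_1&0_{2n\times 2k}\\0_{2n\times 2k}&Q_2\end{bmatrix}\in\mathbb{C}^{4n\times 4k},$$ where $Q_2\in\mathbb{C}^{2n\times 2k}$ is $(J_{2n},J_{2k})$-symplectic, and $Q_1\in\mathbb{C}^{2n\times 2k}$ is such that $Q_1^{*}$ is a left inverse of $Q_2$, i.e. $Q_1^{*}Q_2=I_{2k}$. Let $\mu_1,\ldots,\mu_N\in\mathbb{C}^p$ and $s_1,\ldots,s_N\in\mathbb{C}$ be given. Put $$B_{red}=Q_2^{*}B,\qquad \mathcal{H}_{red}=Q_1^{*}\mathcal{H}Q_1,\qquad R_{red}=Q_2^{*}RQ_2,$$ and assume that $s_mI_{2n}-(J_{2n}-R)\mathcal{H}$ and $s_mI_{2k}-(J_{2k}-R_{red})\mathcal{H}_{red}$ are invertible for $m=1,\ldots,N$. If $(s_mI_{2n}-(J_{2n}-R)\mathcal{H})^{-1}B\mu_m\in\mathrm{ran}(Q_1)$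 for $m=1,\ldots,N$ and $\mathrm{ran}(\mathcal{H}Q_1)\subseteq\mathrm{ran}(Q_2)$, then the reduced-order port-Hamiltonian system $$\dot x_{red}(t)=(J_{2k}-R_{red})\mathcal{H}_{red}x_{red}(t)+B_{red}u(t),\qquad y_{red}(t)=B_{red}^{*}\mathcal{H}_{red}x_{red}(t),$$ with transfer function $G_{red}$, satisfies $G(s_m)\mu_m=G_{red}(s_m)\mu_m$ for $m=1,\ldots,N$.
   Context: $^{*}$ denotes the conjugate transpose and $\mathrm{ran}$ the range (column space). For Hermitian matrices, $>0$ and $\ge 0$ mean positive definite and positive semi-definite. The transfer functions are $G(s)=B^{*}\mathcal{H}(sI_{2n}-(J_{2n}-R)\mathcal{H})^{-1}B$ and $G_{red}(s)=B_{red}^{*}\mathcal{H}_{red}(sI_{2k}-(J_{2k}-R_{red})\mathcal{H}_{red})^{-1}B_{red}$. For invertible skew-Hermitian matrices $J_{2n}\in\mathbb{C}^{2n\times 2n}$ and $J_{2k}\in\mathbb{C}^{2k\times 2k}$ with $k\le n$, a matrix $Q\in\mathbb{C}^{2n\times 2k}$ is called $(J_{2n},J_{2k})$-symplectic if $Q^{*}J_{2n}Q=J_{2k}$. A linear port-Hamiltonian system is a system $\dot x=(J-R)\mathcal{H}x+Bu$, $y=B^{*}\mathcal{H}x$ with $J^{*}=-J$, $R=R^{*}\ge0$, $\mathcal{H}=\mathcal{H}^{*}>0$. *)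

theory Defs
  imports Jordan_Normal_Form.Schur_Decomposition
begin

(* The quadratic form x* A x is real for Hermitian A, so taking its real part loses nothing. *)

definition pos_semidef_mat :: "nat \<Rightarrow> complex mat \<Rightarrow> bool" where
  "pos_semidef_mat d A \<longleftrightarrow> A \<in> carrier_mat d d \<and> mat_adjoint A = A \<and>
     (\<forall>x \<in> carrier_vec d. 0 \<le> Re ((A *\<^sub>v x) \<bullet>c x))"

definition pos_def_mat :: "nat \<Rightarrow> complex mat \<Rightarrow> bool" where
  "pos_def_mat d A \<longleftrightarrow> A \<in> carrier_mat d d \<and> mat_adjoint A = A \<and>
     (\<forall>x \<in> carrier_vec d. x \<noteq> 0\<^sub>v d \<longrightarrow> 0 < Re ((A *\<^sub>v x) \<bullet>c x))"

definition skew_hermitian_mat :: "nat \<Rightarrow> complex mat \<Rightarrow> bool" where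
  "skew_hermitian_mat d A \<longleftrightarrow> A \<in> carrier_mat d d \<and> mat_adjoint A = - A"

(* The system x' = (J - R) H x + B u, y = B* H x with d states and p inputs/outputs,
   given by its coefficient matrices. *)

definition port_hamiltonian ::
  "nat \<Rightarrow> nat \<Rightarrow> complex mat \<Rightarrow> complex mat \<Rightarrow> complex mat \<Rightarrow> complex mat \<Rightarrow> bool" where
  "port_hamiltonian d p J R H B \<longleftrightarrow>
     skew_hermitian_mat d J \<and> pos_semidef_mat d R \<and> pos_def_mat d H \<and> B \<in> carrier_mat d p"

definition pencil ::
  "complex mat \<Rightarrow> complex mat \<Rightarrow> complex mat \<Rightarrow> complex \<Rightarrow> complex mat" where
  "pencil J R H s = s \<cdot>\<^sub>m 1\<^sub>m (dim_row J) - (J - R) * H"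

(* The inverse is only meaningful for invertible matrices; otherwise it is unspecified. *)

definition inv_mat :: "complex mat \<Rightarrow> complex mat" where
  "inv_mat A = the (mat_inverse A)"

definition transfer_function ::
  "complex mat \<Rightarrow> complex mat \<Rightarrow> complex mat \<Rightarrow> complex mat \<Rightarrow> complex \<Rightarrow> complex mat" where
  "transfer_function J R H B s = mat_adjoint B * H * inv_mat (pencil J R H s) * B"

definition symplectic_mat ::
  "nat \<Rightarrow> nat \<Rightarrow> complex mat \<Rightarrow> complex mat \<Rightarrow> complex mat \<Rightarrow> bool" where
  "symplectic_mat n k Jn Jk Q \<longleftrightarrow>
     Q \<in> carrier_mat (2 * n) (2 * k) \<and> mat_adjoint Q * Jn * Q = Jk"

abbreviation mat_range :: "complex mat \<Rightarrow> complex vec set" where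
  "mat_range A \<equiv> vec_space.col_space (dim_row A) A"

end

theory Submission
  imports Defs
begin

(* Q2* is a left inverse of Q1. If x = Q1 z solves the full shifted system and H Q1 z = Q2 w, then
   applying Q1* gives w = H_red z, and applying Q2* to the system shows that z solves the reduced
   shifted system. Both outputs are then B* Q2 H_red z = B* H Q1 z. *)

lemma dim_mat_adjoint [simp]:
  "dim_row (mat_adjoint A) = dim_col A" "dim_col (mat_adjoint A) = dim_row A"
  by (simp_all add: mat_adjoint_def)

lemma mat_adjoint_carrier [simp]:
  "A \<in> carrier_mat m n \<Longrightarrow> mat_adjoint A \<in> carrier_mat n m"
  by (intro carrier_matI) simp_all

lemma index_mat_adjoint [simp]:
  assumes "i < dim_col A" "j < dim_row A"
  shows "mat_adjoint A $$ (i, j) = conjugate (A $$ (j, i))"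
  using assms by (simp add: mat_adjoint_def mat_of_rows_index)

lemma mat_adjoint_adjoint [simp]: "mat_adjoint (mat_adjoint A) = A"
  by (rule eq_matI) auto

lemma mat_adjoint_one [simp]: "mat_adjoint (1\<^sub>m n :: complex mat) = 1\<^sub>m n"
  by (rule eq_matI) auto

lemma mat_adjoint_mult:
  fixes A B :: "'a :: conjugatable_field mat"
  assumes "dim_col A = dim_row B"
  shows "mat_adjoint (A * B) = mat_adjoint B * mat_adjoint A"
  using assms
  by (intro eq_matI)
     (auto simp: scalar_prod_def sum_conjugate conjugate_dist_mul mult.commute)

text \<open>Both sides expand to the same double sum over the entries of \<open>A\<close>, with the
  two summations exchanged.\<close>

lemma cscalar_prod_mat_adjoint:
  fixes A :: "'a :: conjugatable_field mat"
  assumes A: "A \<in> carrier_mat m n" and v: "v \<in> carrier_vec n" and w: "w \<in> carrier_vec m"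
  shows "(A *\<^sub>v v) \<bullet>c w = v \<bullet>c (mat_adjoint A *\<^sub>v w)"
proof -
  have "(A *\<^sub>v v) \<bullet>c w = (\<Sum>i<m. \<Sum>j<n. A $$ (i,j) * v $ j * conjugate (w $ i))"
    using A v w by (simp add: scalar_prod_def lessThan_atLeast0 sum_distrib_right)
  also have "\<dots> = (\<Sum>j<n. \<Sum>i<m. A $$ (i,j) * v $ j * conjugate (w $ i))"
    by (rule sum.swap)
  also have "\<dots> = v \<bullet>c (mat_adjoint A *\<^sub>v w)"
    using A v w by (simp add: scalar_prod_def lessThan_atLeast0 sum_distrib_left sum_conjugate
        conjugate_dist_mul mult_ac)
  finally show ?thesis .
qed

lemma assoc_mult_mat_mat_mat_vec:
  assumes A: "A \<in> carrier_mat a b" and B: "B \<in> carrier_mat b c" and C: "C \<in> carrier_mat c d"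
    and v: "v \<in> carrier_vec d"
  shows "A * B * C *\<^sub>v v = A *\<^sub>v (B *\<^sub>v (C *\<^sub>v v))"
  using assoc_mult_mat_vec[OF mult_carrier_mat[OF A B] C v]
    assoc_mult_mat_vec[OF A B mult_mat_vec_carrier[OF C v]] by simp

text \<open>The leftmost factor moves across the inner product by adjointness. This is what carries
  sign conditions on the quadratic form of \<open>A\<close> over to the compressed matrix.\<close>

lemma cscalar_prod_congruence:
  fixes A Q :: "'a :: conjugatable_field mat"
  assumes A: "A \<in> carrier_mat m m" and Q: "Q \<in> carrier_mat m n" and x: "x \<in> carrier_vec n"
  shows "(mat_adjoint Q * A * Q *\<^sub>v x) \<bullet>c x = (A *\<^sub>v (Q *\<^sub>v x)) \<bullet>c (Q *\<^sub>v x)"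
proof -
  have "mat_adjoint Q * A * Q *\<^sub>v x = mat_adjoint Q *\<^sub>v (A *\<^sub>v (Q *\<^sub>v x))"
    using assoc_mult_mat_mat_mat_vec[OF mat_adjoint_carrier[OF Q] A Q x] .
  then show ?thesis
    using cscalar_prod_mat_adjoint[of "mat_adjoint Q" n m "A *\<^sub>v (Q *\<^sub>v x)" x] A Q x by simp
qed

lemma mat_adjoint_congruence:
  fixes A Q :: "'a :: conjugatable_field mat"
  assumes A: "A \<in> carrier_mat m m" and Q: "Q \<in> carrier_mat m n"
  shows "mat_adjoint (mat_adjoint Q * A * Q) = mat_adjoint Q * mat_adjoint A * Q"
  using A Q by (simp add: mat_adjoint_mult assoc_mult_mat[of _ n m _ m _ n])

lemma pos_semidef_mat_congruence:
  assumes "pos_semidef_mat m A" and Q: "Q \<in> carrier_mat m n"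
  shows "pos_semidef_mat n (mat_adjoint Q * A * Q)"
  using assms mult_carrier_mat[of "mat_adjoint Q * A" n m Q n]
  by (auto simp: pos_semidef_mat_def mat_adjoint_congruence cscalar_prod_congruence)

lemma left_inverse_mult_mat_vec:
  fixes L Q :: "'a :: semiring_1 mat"
  assumes "L \<in> carrier_mat n m" "Q \<in> carrier_mat m n" "L * Q = 1\<^sub>m n" "x \<in> carrier_vec n"
  shows "L *\<^sub>v (Q *\<^sub>v x) = x"
  using assoc_mult_mat_vec[OF assms(1,2,4)] by (simp only: assms(3) one_mult_mat_vec[OF assms(4)])

text \<open>The left inverse \<open>L\<close> makes \<open>Q\<close> injective, so a nonzero
  \<open>x\<close> is sent to a nonzero vector, at which the form of \<open>A\<close> is strictly
  positive.\<close>

lemma pos_def_mat_congruence: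
  assumes "pos_def_mat m A" and Q: "Q \<in> carrier_mat m n"
    and L: "L \<in> carrier_mat n m" "L * Q = 1\<^sub>m n"
  shows "pos_def_mat n (mat_adjoint Q * A * Q)"
proof -
  have "Q *\<^sub>v x \<noteq> 0\<^sub>v m" if x: "x \<in> carrier_vec n" "x \<noteq> 0\<^sub>v n" for x
  proof
    assume "Q *\<^sub>v x = 0\<^sub>v m"
    moreover have "L *\<^sub>v (Q *\<^sub>v x) = x"
      using left_inverse_mult_mat_vec[OF L(1) Q L(2) x(1)] .
    ultimately show False using L x by auto
  qed
  then show ?thesis
    using assms mult_carrier_mat[of "mat_adjoint Q * A" n m Q n]
    by (auto simp: pos_def_mat_def mat_adjoint_congruence cscalar_prod_congruence)
qed

text \<open>Links two notions of inverse: \<open>invertible_mat\<close> speaks of a two-sided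
  inverse, whereas \<open>mat_inverse\<close> is specified through the units of the matrix
  ring.\<close>

lemma inv_mat:
  assumes A: "A \<in> carrier_mat n n" and "invertible_mat A"
  shows "inv_mat A \<in> carrier_mat n n" "A * inv_mat A = 1\<^sub>m n" "inv_mat A * A = 1\<^sub>m n"
proof -
  obtain B where B: "A * B = 1\<^sub>m n" "B * A = 1\<^sub>m (dim_row B)"
    using assms by (auto simp: invertible_mat_def inverts_mat_def)
  \<comment> \<open>\<open>invertible_mat\<close> fixes no dimensions for the inverse. Comparing
    column counts in the two identities gives \<open>dim_col B = n\<close> and
    \<open>dim_row B = n\<close>.\<close>
  have "B \<in> carrier_mat n n"
    using A arg_cong[OF B(1), of dim_col] arg_cong[OF B(2), of dim_col] by auto
  then have "A \<in> Units (ring_mat TYPE(complex) n ())"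
    using A B by (auto simp: Units_def ring_mat_def)
  then obtain C where "mat_inverse A = Some C"
    using mat_inverse(1)[OF A, of "()"] by (cases "mat_inverse A") auto
  then show "inv_mat A \<in> carrier_mat n n" "A * inv_mat A = 1\<^sub>m n" "inv_mat A * A = 1\<^sub>m n"
    using mat_inverse(2)[OF A] by (auto simp: inv_mat_def)
qed

text \<open>Turns membership in a column space into an explicit coefficient vector; the vectors
  \<open>z\<close> and \<open>w\<close> of the main proof arise this way.\<close>

lemma mat_range_eq:
  assumes "A \<in> carrier_mat m n"
  shows "mat_range A = {A *\<^sub>v x | x. x \<in> carrier_vec n}"
  using assms by (subst vec_space.col_space_eq[of _ "dim_row A" n]) auto

lemma pencil_carrier:
  assumes "J \<in> carrier_mat d d" "R \<in> carrier_mat d d" "H \<in> carrier_mat d d"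
  shows "pencil J R H s \<in> carrier_mat d d"
  using assms by (auto simp: pencil_def)

lemma pencil_mult_vec:
  assumes "J \<in> carrier_mat d d" "R \<in> carrier_mat d d" "H \<in> carrier_mat d d" "x \<in> carrier_vec d"
  shows "pencil J R H s *\<^sub>v x = s \<cdot>\<^sub>v x - (J - R) *\<^sub>v (H *\<^sub>v x)"
proof -
  have "J - R \<in> carrier_mat d d" using assms by auto
  moreover have "(s \<cdot>\<^sub>m 1\<^sub>m d) *\<^sub>v x = s \<cdot>\<^sub>v x"
    using assms by (intro eq_vecI) auto
  ultimately show ?thesis
    using assms by (simp add: pencil_def minus_mult_distrib_mat_vec[of _ d d])
qed

text \<open>In nested form the state and \<open>H\<close> applied to it appear as subterms that can
  be rewritten. The carrier premise on the inverse comes from lemma \<open>inv_mat\<close>, because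
  an unspecified inverse has no known dimensions.\<close>

lemma transfer_function_mult_vec:
  assumes H: "H \<in> carrier_mat d d" and B: "B \<in> carrier_mat d p"
    and K: "inv_mat (pencil J R H s) \<in> carrier_mat d d" and u: "u \<in> carrier_vec p"
  shows "transfer_function J R H B s *\<^sub>v u
    = mat_adjoint B *\<^sub>v (H *\<^sub>v (inv_mat (pencil J R H s) *\<^sub>v (B *\<^sub>v u)))"
proof -
  note Ba = mat_adjoint_carrier[OF B]
  note Ku = mult_mat_vec_carrier[OF K mult_mat_vec_carrier[OF B u]]
  show ?thesis
    unfolding transfer_function_def
      assoc_mult_mat_mat_mat_vec[OF mult_carrier_mat[OF Ba H] K B u] assoc_mult_mat_vec[OF Ba H Ku] ..
qed

theorem theorem5:
  fixes n k p N :: nat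
    and J2n R H B J2k QE Q1 Q2 Bred Hred Rred :: "complex mat"
    and G Gred :: "complex \<Rightarrow> complex mat"
    and \<mu> :: "nat \<Rightarrow> complex vec"
    and s :: "nat \<Rightarrow> complex"
  assumes "k < n"
    and "port_hamiltonian (2 * n) p J2n R H B"
    and "invertible_mat J2n"
    and "G = transfer_function J2n R H B"
    and "skew_hermitian_mat (2 * k) J2k"
    and "invertible_mat J2k"
    and "QE = four_block_mat Q1 (0\<^sub>m (2 * n) (2 * k)) (0\<^sub>m (2 * n) (2 * k)) Q2"
    and "symplectic_mat n k J2n J2k Q2"
    and "Q1 \<in> carrier_mat (2 * n) (2 * k)"
    and "mat_adjoint Q1 * Q2 = 1\<^sub>m (2 * k)"
    and "\<And>m. m \<in> {1..N} \<Longrightarrow> \<mu> m \<in> carrier_vec p"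
    and "Bred = mat_adjoint Q2 * B"
    and "Hred = mat_adjoint Q1 * H * Q1"
    and "Rred = mat_adjoint Q2 * R * Q2"
    and "Gred = transfer_function J2k Rred Hred Bred"
    and "\<And>m. m \<in> {1..N} \<Longrightarrow> invertible_mat (pencil J2n R H (s m))"
    and "\<And>m. m \<in> {1..N} \<Longrightarrow> invertible_mat (pencil J2k Rred Hred (s m))"
    and "\<And>m. m \<in> {1..N} \<Longrightarrow> inv_mat (pencil J2n R H (s m)) * B *\<^sub>v \<mu> m \<in> mat_range Q1"
    and "mat_range (H * Q1) \<subseteq> mat_range Q2"
  shows "port_hamiltonian (2 * k) p J2k Rred Hred Bred \<and>
         (\<forall>m \<in> {1..N}. G (s m) *\<^sub>v \<mu> m = Gred (s m) *\<^sub>v \<mu> m)"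
proof -
  have J: "J2n \<in> carrier_mat (2*n) (2*n)" and R: "R \<in> carrier_mat (2*n) (2*n)"
    and H: "H \<in> carrier_mat (2*n) (2*n)" and B: "B \<in> carrier_mat (2*n) p"
    and psd: "pos_semidef_mat (2*n) R" and pd: "pos_def_mat (2*n) H"
    using assms(2) by (auto simp: port_hamiltonian_def skew_hermitian_mat_def
        pos_semidef_mat_def pos_def_mat_def)
  have Jk: "J2k \<in> carrier_mat (2*k) (2*k)"
    using assms(5) by (simp add: skew_hermitian_mat_def)
  have Q2: "Q2 \<in> carrier_mat (2*n) (2*k)" and symp: "mat_adjoint Q2 * J2n * Q2 = J2k"
    using assms(8) by (auto simp: symplectic_mat_def)
  note Q1 = assms(9)
  have Q1a: "mat_adjoint Q1 \<in> carrier_mat (2*k) (2*n)" and Q2a: "mat_adjoint Q2 \<in> carrier_mat (2*k) (2*n)"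
    and Ba: "mat_adjoint B \<in> carrier_mat p (2*n)"
    using Q1 Q2 B by auto
  \<comment> \<open>Taking adjoints in the biorthogonality hypothesis yields a left inverse of
    \<open>Q1\<close>. It serves twice: for definiteness of \<open>Hred\<close> and for projecting
    the state equation.\<close>
  have "mat_adjoint (mat_adjoint Q1 * Q2) = mat_adjoint Q2 * Q1"
    using Q1 Q2 by (simp add: mat_adjoint_mult)
  then have Q21: "mat_adjoint Q2 * Q1 = 1\<^sub>m (2*k)"
    by (simp add: assms(10))
  \<comment> \<open>The structure survives because \<open>Rred\<close> and \<open>Hred\<close> are
    congruences, by \<open>Q2\<close> and \<open>Q1\<close> respectively; skewness of
    \<open>J2k\<close> is a hypothesis.\<close>
  have ph: "port_hamiltonian (2 * k) p J2k Rred Hred Bred"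
    unfolding port_hamiltonian_def assms(12-14)
    using assms(5) pos_semidef_mat_congruence[OF psd Q2] pos_def_mat_congruence[OF pd Q1 Q2a Q21]
      Q2a B by auto
  then have Rk: "Rred \<in> carrier_mat (2*k) (2*k)" and Hk: "Hred \<in> carrier_mat (2*k) (2*k)"
    and Bk: "Bred \<in> carrier_mat (2*k) p"
    by (auto simp: port_hamiltonian_def pos_semidef_mat_def pos_def_mat_def)
  have "G (s m) *\<^sub>v \<mu> m = Gred (s m) *\<^sub>v \<mu> m" if m: "m \<in> {1..N}" for m
  proof -
    define P where "P = pencil J2n R H (s m)"
    define Pk where "Pk = pencil J2k Rred Hred (s m)"
    have P: "P \<in> carrier_mat (2*n) (2*n)" and Pk: "Pk \<in> carrier_mat (2*k) (2*k)"
      unfolding P_def Pk_def by (intro pencil_carrier J R H Jk Rk Hk)+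
    note iP = inv_mat[OF P assms(16)[OF m, folded P_def]]
    note iPk = inv_mat[OF Pk assms(17)[OF m, folded Pk_def]]
    note u = assms(11)[OF m]
    have Bu: "B *\<^sub>v \<mu> m \<in> carrier_vec (2*n)" using B u by simp
    \<comment> \<open>\<open>z\<close> holds the coordinates of the full state in the columns of
      \<open>Q1\<close>; it will turn out to be the reduced state.\<close>
    obtain z where z: "z \<in> carrier_vec (2*k)" and "inv_mat P * B *\<^sub>v \<mu> m = Q1 *\<^sub>v z"
      using assms(18)[OF m] unfolding mat_range_eq[OF Q1] P_def by auto
    then have xz: "inv_mat P *\<^sub>v (B *\<^sub>v \<mu> m) = Q1 *\<^sub>v z"
      using assoc_mult_mat_vec[OF iP(1) B u] by simp
    have Qz: "Q1 *\<^sub>v z \<in> carrier_vec (2*n)" using Q1 z by simp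
    have HQ1: "H * Q1 \<in> carrier_mat (2*n) (2*k)" using H Q1 by simp
    obtain w where w: "w \<in> carrier_vec (2*k)" and "H * Q1 *\<^sub>v z = Q2 *\<^sub>v w"
      using assms(19) z unfolding mat_range_eq[OF HQ1] mat_range_eq[OF Q2] by auto
    then have Hw: "H *\<^sub>v (Q1 *\<^sub>v z) = Q2 *\<^sub>v w"
      using H Q1 z by simp
    have "Hred *\<^sub>v z = mat_adjoint Q1 *\<^sub>v (H *\<^sub>v (Q1 *\<^sub>v z))"
      unfolding assms(13)
      by (rule assoc_mult_mat_mat_mat_vec[OF Q1a H Q1 z])
    also have "\<dots> = w"
      unfolding Hw by (rule left_inverse_mult_mat_vec[OF Q1a Q2 assms(10) w])
    finally have Hz: "Hred *\<^sub>v z = w" .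
    have JRc: "J2n - R \<in> carrier_mat (2*n) (2*n)" using J R by auto
    \<comment> \<open>Symplecticity of \<open>Q2\<close> enters here: it compresses
      \<open>J2n\<close> to \<open>J2k\<close>, just as \<open>R\<close> is compressed to
      \<open>Rred\<close>.\<close>
    have JR: "mat_adjoint Q2 * (J2n - R) * Q2 = J2k - Rred"
      unfolding assms(14) symp[symmetric]
      unfolding mult_minus_distrib_mat[OF Q2a J R]
      by (rule minus_mult_distrib_mat[OF mult_carrier_mat[OF Q2a J] mult_carrier_mat[OF Q2a R] Q2])
    have "P *\<^sub>v (Q1 *\<^sub>v z) = B *\<^sub>v \<mu> m"
      using left_inverse_mult_mat_vec[OF P iP(1,2) Bu] by (simp only: xz)
    \<comment> \<open>Having replaced the gradient \<open>H Q1 z\<close> by \<open>Q2 w\<close>, the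
      projection meets \<open>J2n - R\<close> with \<open>Q2\<close> on both sides, as
      \<open>JR\<close> requires, while in the shift term it cancels \<open>Q1\<close>.\<close>
    then have "mat_adjoint Q2 *\<^sub>v (B *\<^sub>v \<mu> m)
        = mat_adjoint Q2 *\<^sub>v (s m \<cdot>\<^sub>v (Q1 *\<^sub>v z) - (J2n - R) *\<^sub>v (Q2 *\<^sub>v w))"
      unfolding P_def pencil_mult_vec[OF J R H Qz] Hw by simp
    also have "\<dots> = mat_adjoint Q2 *\<^sub>v (s m \<cdot>\<^sub>v (Q1 *\<^sub>v z))
        - mat_adjoint Q2 *\<^sub>v ((J2n - R) *\<^sub>v (Q2 *\<^sub>v w))"
      using Q2a Qz Q2 w JRc by (intro mult_minus_distrib_mat_vec) auto
    also have "mat_adjoint Q2 *\<^sub>v (s m \<cdot>\<^sub>v (Q1 *\<^sub>v z)) = s m \<cdot>\<^sub>v z"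
      unfolding mult_mat_vec[OF Q2a Qz] left_inverse_mult_mat_vec[OF Q2a Q1 Q21 z] ..
    also have "mat_adjoint Q2 *\<^sub>v ((J2n - R) *\<^sub>v (Q2 *\<^sub>v w)) = (J2k - Rred) *\<^sub>v w"
      unfolding JR[symmetric]
      by (rule assoc_mult_mat_mat_mat_vec[OF Q2a JRc Q2 w, symmetric])
    finally have "Bred *\<^sub>v \<mu> m = Pk *\<^sub>v z"
      unfolding Pk_def pencil_mult_vec[OF Jk Rk Hk z] Hz assms(12)
      using assoc_mult_mat_vec[OF Q2a B u] by simp
    \<comment> \<open>Invertibility of the reduced pencil makes its solution unique, which
      identifies \<open>z\<close>.\<close>
    then have zk: "inv_mat Pk *\<^sub>v (Bred *\<^sub>v \<mu> m) = z"
      using left_inverse_mult_mat_vec[OF iPk(1) Pk iPk(3) z] by simp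
    have "Gred (s m) *\<^sub>v \<mu> m = mat_adjoint Bred *\<^sub>v (Hred *\<^sub>v (inv_mat Pk *\<^sub>v (Bred *\<^sub>v \<mu> m)))"
      unfolding assms(15) Pk_def
      by (rule transfer_function_mult_vec[OF Hk Bk iPk(1)[unfolded Pk_def] u])
    also have "\<dots> = mat_adjoint B *\<^sub>v (Q2 *\<^sub>v w)"
      unfolding zk Hz
      unfolding assms(12) using assoc_mult_mat_vec[OF Ba Q2 w] Q2 B by (simp add: mat_adjoint_mult)
    \<comment> \<open>The range relation is now read backwards: \<open>Q2 w\<close> is the full
      gradient at the full state.\<close>
    also have "\<dots> = mat_adjoint B *\<^sub>v (H *\<^sub>v (inv_mat P *\<^sub>v (B *\<^sub>v \<mu> m)))"
      unfolding xz Hw ..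
    also have "\<dots> = G (s m) *\<^sub>v \<mu> m"
      unfolding assms(4) P_def
      by (rule transfer_function_mult_vec[OF H B iP(1)[unfolded P_def] u, symmetric])
    finally show ?thesis ..
  qed
  with ph show ?thesis by blast
qed

end
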